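(* Consider a binary privacy level game with $N\ge 2$ users and a platform, as described in the context. If $U$ satisfies Assumptions 1 and 2 of the context, and the platform payments are the fair payments of the context with constant $\alpha\in[0,1]$, then the optimal $\alpha^*$ for the platform's problem $$\max_{\alpha}\ (1-\alpha)\,\bar U(p^*(\alpha))\quad\text{subject to}\quad p^*(\alpha)\in\mathrm{NE}(\alpha)\qquad(\ast)$$ can be divided into three regimes depending on $c$. The boundaries of these regimes are $\gamma_{max}=\max_p\gamma(p)$ and some $c_{th}<\gamma_{max}$ such that: 1. When $c>\gamma_{max}$, $\alpha^*=0$ is the maximizer of $(\ast)$. 2. When $c_{th}<c<\gamma_{max}$, $\alpha^*$ is the minimizing $\alpha\in[0,1]$ such that $p^*(\alpha)\in\gamma^{-1}(c/\alpha)$. 3. When $c<c_{th}$, $\alpha^*$ is the smallest $\alpha\in[0,1]$ such that $p^*(\alpha)=0$. Here $$c_{th}=\max\left\{c\ :\ \frac{1-c/\gamma_{min}}{1-\alpha}-\frac{\bar U(p^*(\alpha))}{\bar U(0)}\ge 0\ \ \text{for all }\alpha\le c/\gamma_{min}\right\},$$ where $\gamma_{min}=\min_p\gamma(p)$, $\alpha$ ranges over $[0,1)$, and $p^*(\alpha)$ is the equilibrium for the sensitivity $c$ in question.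
   Context: Users are $[N]=\{1,\dots,N\}$. Each user chooses one of two privacy levels $\{\rho_1',\rho_2'\}\subseteq\mathbb{R}_{\ge 0}\cup\{\infty\}$ with $\rho_2'>\rho_1'$; $\rho_1'$ is the more private option. The platform derives a real-valued utility $U$ from the vector of privacy levels. For $\boldsymbol{\rho}\in\{\rho_1',\rho_2'\}^N$ and $S\subseteq[N]$, $\boldsymbol{\rho}_S$ has $i$-th entry $\rho_i$ if $i\in S$ and $0$ otherwise. Users have identical marginal contribution: $U$ is invariant under permutations of the users. Assumption 1 (monotone). For all $S\subseteq[N]$: if $\boldsymbol{\rho}^{(2)}_S\ge\boldsymbol{\rho}^{(1)}_S$ entrywise and $\boldsymbol{\rho}^{(2)}_S\ne\boldsymbol{\rho}^{(1)}_S$, then $U(\boldsymbol{\rho}^{(2)}_S)>U(\boldsymbol{\rho}^{(1)}_S)$. Assumption 2 (diminishing returns). Let $n_{\text{private}}(\boldsymbol{\rho}_S)$ be the number of $i\in S$ with $\rho_i=\rho_1'$. Let $\Delta_iU(\boldsymbol{\rho}_S)=U(\boldsymbol{\rho}_S^{(i+)})-U(\boldsymbol{\rho}_S)$, where $\boldsymbol{\rho}_S^{(i+)}$ equals $\boldsymbol{\rho}_S$ except that its $i$-th entry is $\rho_2'$ (the marginal increase in utility when user $i$ switches to the lower privacy option). For $i\in S$ and $\rho_i^{(1)}=\rho_i^{(2)}=\rho_1'$: if $n_{\text{private}}(\boldsymbol{\rho}^{(1)}_S)>n_{\text{private}}(\boldsymbol{\rho}^{(2)}_S)$, then $\Delta_iU(\boldsymbol{\rho}^{(1)}_S)>\Delta_iU(\boldsymbol{\rho}^{(2)}_S)$.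 Fair payments with constant $\alpha$. User $i$ receives $\alpha\,\phi(\rho_i;\boldsymbol{\rho}_{-i})$, where $\alpha\in[0,1]$ is chosen by the platform, $\boldsymbol{\rho}_{-i}$ is the vector of the other users' levels, and $$\phi(\rho_i;\boldsymbol{\rho}_{-i})=\frac1N\sum_{S\subseteq[N]\setminus\{i\}}\frac{1}{\binom{N-1}{|S|}}\bigl(U(\boldsymbol{\rho}_{S\cup\{i\}})-U(\boldsymbol{\rho}_S)\bigr),$$ which by the equal marginal contribution assumption does not depend on the index $i$. User utility. User $i$ has utility $\alpha\,\phi(\rho_i;\boldsymbol{\rho}_{-i})-c\,\mathbf{1}\{\rho_i=\rho_2'\}$, where $c\ge 0$ is the privacy sensitivity, the same for all users. Mixed strategies. For $p\in[0,1]$, the mixed strategy $\mathbf{p}=[p,1-p]^T$ chooses $\rho_1'$ with probability $p$ and $\rho_2'$ with probability $1-p$, independently across users; it is identified with the scalar $p$. $\mathrm{NE}(\alpha)$ is the set of symmetric Nash equilibria $p$ of the game among the users when the platform uses $\alpha$: no user gains in expected utility by deviating from $p$ when all other users play $p$. $p^*(\alpha)$ denotes an equilibrium in $\mathrm{NE}(\alpha)$; it depends on $c$. Expected relative payoff: $\gamma(p)=\mathbb{E}\left[\phi(\rho_2';\boldsymbol{\rho}_{-i})-\phi(\rho_1';\boldsymbol{\rho}_{-i})\right]$, where all users $j\ne i$ play $p$. Expected utility: $\bar U(p)=\mathbb{E}[U(\boldsymbol{\rho})]$ when all $N$ users play $p$.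
   Formalization: Assumes U ≥ 0 when all users choose ρ1' (else item 1 fails). Item 1: 0 is the only maximizer if Ū(1)>0, else one of several. Item 2: α* is the least α with p ∈ γ^{-1}(c/α) for p fixed as the optimal equilibrium, p≠0, with γ^{-1}(∞)={1} at α=0. *)

theory Defs
  imports "HOL-Probability.Probability"
begin

text \<open>
  Users are the numbers \<open>{1..N}\<close>, privacy levels are extended nonnegative reals, and a vector of
  levels is a function \<open>nat \<Rightarrow> ennreal\<close>. The utility \<open>U\<close> is only ever applied to vectors that vanish
  outside \<open>{1..N}\<close>, so its values elsewhere are irrelevant.
\<close>

definition profiles :: "nat \<Rightarrow> ennreal \<Rightarrow> ennreal \<Rightarrow> (nat \<Rightarrow> ennreal) set" where
  "profiles N r1 r2 = {1..N} \<rightarrow> {r1, r2}"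

definition restr :: "nat set \<Rightarrow> (nat \<Rightarrow> ennreal) \<Rightarrow> nat \<Rightarrow> ennreal" where
  "restr S \<rho> = (\<lambda>i. if i \<in> S then \<rho> i else 0)"

definition equal_marginal_contribution ::
    "nat \<Rightarrow> ennreal \<Rightarrow> ennreal \<Rightarrow> ((nat \<Rightarrow> ennreal) \<Rightarrow> real) \<Rightarrow> bool" where
  "equal_marginal_contribution N r1 r2 U \<longleftrightarrow>
     (\<forall>S\<subseteq>{1..N}. \<forall>\<rho>\<in>profiles N r1 r2. \<forall>\<pi>. \<pi> permutes {1..N} \<longrightarrow>
        U (restr S \<rho> \<circ> \<pi>) = U (restr S \<rho>))"

definition monotone_utility ::
    "nat \<Rightarrow> ennreal \<Rightarrow> ennreal \<Rightarrow> ((nat \<Rightarrow> ennreal) \<Rightarrow> real) \<Rightarrow> bool" where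
  "monotone_utility N r1 r2 U \<longleftrightarrow>
     (\<forall>S\<subseteq>{1..N}. \<forall>\<rho>\<in>profiles N r1 r2. \<forall>\<rho>'\<in>profiles N r1 r2.
        (\<forall>i\<in>{1..N}. restr S \<rho> i \<le> restr S \<rho>' i) \<and> restr S \<rho>' \<noteq> restr S \<rho> \<longrightarrow>
        U (restr S \<rho>) < U (restr S \<rho>'))"

text \<open>
  \<open>r1\<close> may be \<open>0\<close>, in which case a private user in \<open>S\<close> is indistinguishable from a non-member in
  \<open>restr S \<rho>\<close>; hence the number of private users depends on \<open>S\<close> and \<open>\<rho>\<close>, not on \<open>restr S \<rho>\<close>.
\<close>

definition n_private :: "ennreal \<Rightarrow> nat set \<Rightarrow> (nat \<Rightarrow> ennreal) \<Rightarrow> nat" where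
  "n_private r1 S \<rho> = card {i \<in> S. \<rho> i = r1}"

definition marginal_increase ::
    "ennreal \<Rightarrow> ((nat \<Rightarrow> ennreal) \<Rightarrow> real) \<Rightarrow> nat \<Rightarrow> nat set \<Rightarrow> (nat \<Rightarrow> ennreal) \<Rightarrow> real" where
  "marginal_increase r2 U i S \<rho> = U ((restr S \<rho>)(i := r2)) - U (restr S \<rho>)"

definition diminishing_returns ::
    "nat \<Rightarrow> ennreal \<Rightarrow> ennreal \<Rightarrow> ((nat \<Rightarrow> ennreal) \<Rightarrow> real) \<Rightarrow> bool" where
  "diminishing_returns N r1 r2 U \<longleftrightarrow>
     (\<forall>S\<subseteq>{1..N}. \<forall>i\<in>S. \<forall>\<rho>\<in>profiles N r1 r2. \<forall>\<rho>'\<in>profiles N r1 r2.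
        \<rho> i = r1 \<and> \<rho>' i = r1 \<and> n_private r1 S \<rho> > n_private r1 S \<rho>' \<longrightarrow>
        marginal_increase r2 U i S \<rho> > marginal_increase r2 U i S \<rho>')"

definition fair_value ::
    "nat \<Rightarrow> ((nat \<Rightarrow> ennreal) \<Rightarrow> real) \<Rightarrow> nat \<Rightarrow> (nat \<Rightarrow> ennreal) \<Rightarrow> real" where
  "fair_value N U i \<rho> =
     1 / real N * (\<Sum>S\<in>Pow ({1..N} - {i}).
        1 / real ((N - 1) choose card S) * (U (restr (insert i S) \<rho>) - U (restr S \<rho>)))"

definition user_utility ::
    "nat \<Rightarrow> ennreal \<Rightarrow> ((nat \<Rightarrow> ennreal) \<Rightarrow> real) \<Rightarrow> real \<Rightarrow> real \<Rightarrow> nat \<Rightarrow> (nat \<Rightarrow> ennreal) \<Rightarrow> real" where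
  "user_utility N r2 U c \<alpha> i \<rho> = \<alpha> * fair_value N U i \<rho> - c * (if \<rho> i = r2 then 1 else 0)"

definition mixed :: "ennreal \<Rightarrow> ennreal \<Rightarrow> real \<Rightarrow> ennreal pmf" where
  "mixed r1 r2 p = map_pmf (\<lambda>b. if b then r1 else r2) (bernoulli_pmf p)"

definition deviation_utility ::
    "nat \<Rightarrow> ennreal \<Rightarrow> ennreal \<Rightarrow> ((nat \<Rightarrow> ennreal) \<Rightarrow> real) \<Rightarrow> real \<Rightarrow> real \<Rightarrow> nat \<Rightarrow> real \<Rightarrow> real \<Rightarrow> real"
  where
  "deviation_utility N r1 r2 U c \<alpha> i q p =
     measure_pmf.expectation
       (Pi_pmf {1..N} 0 (\<lambda>j. mixed r1 r2 (if j = i then q else p)))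
       (user_utility N r2 U c \<alpha> i)"

definition NE ::
    "nat \<Rightarrow> ennreal \<Rightarrow> ennreal \<Rightarrow> ((nat \<Rightarrow> ennreal) \<Rightarrow> real) \<Rightarrow> real \<Rightarrow> real \<Rightarrow> real set" where
  "NE N r1 r2 U c \<alpha> =
     {p \<in> {0..1}. \<forall>i\<in>{1..N}. \<forall>q\<in>{0..1}.
        deviation_utility N r1 r2 U c \<alpha> i q p \<le> deviation_utility N r1 r2 U c \<alpha> i p p}"

definition relative_payoff ::
    "nat \<Rightarrow> ennreal \<Rightarrow> ennreal \<Rightarrow> ((nat \<Rightarrow> ennreal) \<Rightarrow> real) \<Rightarrow> nat \<Rightarrow> real \<Rightarrow> real" where
  "relative_payoff N r1 r2 U i p =
     measure_pmf.expectation
       (Pi_pmf ({1..N} - {i}) 0 (\<lambda>_. mixed r1 r2 p))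
       (\<lambda>\<rho>. fair_value N U i (\<rho>(i := r2)) - fair_value N U i (\<rho>(i := r1)))"

text \<open>
  The inverse image of \<open>c / \<alpha>\<close> under the relative payoff is needed at \<open>\<alpha> = 0\<close> too, where
  \<open>c / 0 = \<infinity>\<close> for \<open>c > 0\<close> (as division on \<open>ereal\<close> has it). Convention: the inverse image of \<open>\<infinity>\<close>
  is \<open>{1}\<close>, the mixed strategy played when the cost \<open>c\<close> outweighs any payment.
  At finite arguments this is the ordinary inverse image in \<open>[0,1]\<close>.
\<close>

definition inv_relative_payoff ::
    "nat \<Rightarrow> ennreal \<Rightarrow> ennreal \<Rightarrow> ((nat \<Rightarrow> ennreal) \<Rightarrow> real) \<Rightarrow> nat \<Rightarrow> ereal \<Rightarrow> real set" where
  "inv_relative_payoff N r1 r2 U i y =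
     (if y = \<infinity> then {1} else {p \<in> {0..1}. ereal (relative_payoff N r1 r2 U i p) = y})"

definition expected_utility ::
    "nat \<Rightarrow> ennreal \<Rightarrow> ennreal \<Rightarrow> ((nat \<Rightarrow> ennreal) \<Rightarrow> real) \<Rightarrow> real \<Rightarrow> real" where
  "expected_utility N r1 r2 U p =
     measure_pmf.expectation (Pi_pmf {1..N} 0 (\<lambda>_. mixed r1 r2 p)) U"

text \<open>
  The platform's problem is posed over pairs of an \<open>\<alpha>\<close> and an equilibrium for it. This matters only
  for \<open>c = 0\<close>, \<open>\<alpha> = 0\<close>, where every \<open>p\<close> is an equilibrium.
\<close>

definition platform_optimal ::
    "nat \<Rightarrow> ennreal \<Rightarrow> ennreal \<Rightarrow> ((nat \<Rightarrow> ennreal) \<Rightarrow> real) \<Rightarrow> real \<Rightarrow> real \<Rightarrow> real \<Rightarrow> bool" where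
  "platform_optimal N r1 r2 U c \<alpha> p \<longleftrightarrow>
     is_arg_max (\<lambda>(a, s). (1 - a) * expected_utility N r1 r2 U s)
       (\<lambda>(a, s). a \<in> {0..1} \<and> s \<in> NE N r1 r2 U c a) (\<alpha>, p)"

definition optimal_alphas ::
    "nat \<Rightarrow> ennreal \<Rightarrow> ennreal \<Rightarrow> ((nat \<Rightarrow> ennreal) \<Rightarrow> real) \<Rightarrow> real \<Rightarrow> real set" where
  "optimal_alphas N r1 r2 U c = {\<alpha>. \<exists>p. platform_optimal N r1 r2 U c \<alpha> p}"

definition threshold_set ::
    "nat \<Rightarrow> ennreal \<Rightarrow> ennreal \<Rightarrow> ((nat \<Rightarrow> ennreal) \<Rightarrow> real) \<Rightarrow> real \<Rightarrow> real set" where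
  "threshold_set N r1 r2 U \<gamma>min =
     {c. 0 \<le> c \<and> (\<forall>\<alpha>\<in>{0..<1}. \<alpha> \<le> c / \<gamma>min \<longrightarrow> (\<forall>p\<in>NE N r1 r2 U c \<alpha>.
        (1 - c / \<gamma>min) / (1 - \<alpha>) - expected_utility N r1 r2 U p / expected_utility N r1 r2 U 0 \<ge> 0))}"

definition is_greatest :: "real set \<Rightarrow> real \<Rightarrow> bool" where
  "is_greatest A m \<longleftrightarrow> m \<in> A \<and> (\<forall>x\<in>A. x \<le> m)"

definition is_smallest :: "real set \<Rightarrow> real \<Rightarrow> bool" where
  "is_smallest A m \<longleftrightarrow> m \<in> A \<and> (\<forall>x\<in>A. m \<le> x)"

end

theory Submission
  imports Defs
begin

text \<open>
  Expectations over mixed profiles are Bernstein polynomials in \<open>p\<close>, averaging a function of the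
  random set \<open>T\<close> of private users. By diminishing returns the gain from switching to \<open>r2\<close>
  increases strictly with \<open>T\<close>, so \<open>\<gamma>\<close> is continuous, positive and strictly increasing; by
  monotonicity \<open>U\<close> decreases with \<open>T\<close>, so the expected utility \<open>V\<close> is strictly decreasing.
  A user's payoff is affine in the own mixed strategy with slope \<open>c - \<alpha> \<gamma> p\<close>, hence an equilibrium
  is either \<open>0\<close> with \<open>c \<le> \<alpha> \<gamma> 0\<close>, or \<open>1\<close> with \<open>\<alpha> \<gamma> 1 \<le> c\<close>, or satisfies \<open>\<alpha> = c / \<gamma> p\<close>.
  The platform thus compares the values \<open>(1 - c / \<gamma> p) V p\<close> and, at \<open>\<alpha> = 0\<close>, the value \<open>V 1\<close>.
  That \<open>p = 0\<close> is optimal is a family of inequalities affine in \<open>c\<close>, all strict at \<open>c = 0\<close> (for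
  \<open>p > 0\<close>): they hold on a compact interval of \<open>c\<close>, and strictly below its right end \<open>c_th\<close>.
\<close>

section \<open>Means over random subsets\<close>

text \<open>The mean of \<open>F T\<close> when \<open>T\<close> contains each element of \<open>A\<close> independently with probability \<open>p\<close>.\<close>

definition bern_mean :: "'a set \<Rightarrow> ('a set \<Rightarrow> real) \<Rightarrow> real \<Rightarrow> real" where
  "bern_mean A F p = (\<Sum>T\<in>Pow A. p ^ card T * (1 - p) ^ card (A - T) * F T)"

lemma bern_mean_empty [simp]: "bern_mean {} F p = F {}"
  by (simp add: bern_mean_def)

text \<open>Conditioning on whether \<open>x\<close> lies in the random set; the inductions over
  \<open>A\<close> below rest on this recursion.\<close>

lemma bern_mean_insert:
  assumes "finite A" "x \<notin> A"
  shows "bern_mean (insert x A) F p =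
    p * bern_mean A (\<lambda>T. F (insert x T)) p + (1 - p) * bern_mean A F p"
proof -
  let ?w = "\<lambda>B T. p ^ card T * (1 - p) ^ card (B - T)"
  have inj: "inj_on (insert x) (Pow A)"
    using assms(2) by (auto simp: inj_on_def)
  have out: "?w (insert x A) T = (1 - p) * ?w A T" if "T \<subseteq> A" for T
  proof -
    have "insert x A - T = insert x (A - T)" "x \<notin> A - T"
      using that assms(2) by auto
    then show ?thesis using assms(1) by simp
  qed
  have inn: "?w (insert x A) (insert x T) * F (insert x T) = p * (?w A T * F (insert x T))"
    if "T \<subseteq> A" for T
  proof -
    have "insert x A - insert x T = A - T" "x \<notin> T" "finite T"
      using that assms finite_subset by auto
    then show ?thesis by simp
  qed
  have "bern_mean (insert x A) F p =
    (\<Sum>T\<in>Pow A. ?w (insert x A) T * F T) + (\<Sum>T\<in>insert x ` Pow A. ?w (insert x A) T * F T)"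
    unfolding bern_mean_def Pow_insert
    using assms by (subst sum.union_disjoint) auto
  also have "(\<Sum>T\<in>insert x ` Pow A. ?w (insert x A) T * F T) =
      (\<Sum>T\<in>Pow A. p * (?w A T * F (insert x T)))"
    unfolding sum.reindex[OF inj] o_def by (intro sum.cong refl inn) simp
  also have "(\<Sum>T\<in>Pow A. ?w (insert x A) T * F T) = (\<Sum>T\<in>Pow A. (1 - p) * (?w A T * F T))"
    by (intro sum.cong refl) (auto simp: out)
  finally show ?thesis
    by (simp add: bern_mean_def sum_distrib_left)
qed

lemma bern_mean_cong:
  "(\<And>T. T \<subseteq> A \<Longrightarrow> F T = G T) \<Longrightarrow> bern_mean A F p = bern_mean A G p"
  by (auto simp: bern_mean_def intro!: sum.cong)

lemma bern_mean_diff: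
  "bern_mean A (\<lambda>T. F T - G T) p = bern_mean A F p - bern_mean A G p"
  by (simp add: bern_mean_def right_diff_distrib sum_subtractf)

lemma bern_mean_uminus: "bern_mean A (\<lambda>T. - F T) p = - bern_mean A F p"
  by (simp add: bern_mean_def sum_negf)

lemma bern_mean_cmult: "bern_mean A (\<lambda>T. a * F T) p = a * bern_mean A F p"
  by (simp add: bern_mean_def sum_distrib_left mult_ac)

lemma bern_mean_const: "finite A \<Longrightarrow> bern_mean A (\<lambda>T. a) p = a"
  by (induction A rule: finite_induct) (auto simp: bern_mean_insert algebra_simps)

lemma bern_mean_1: "finite A \<Longrightarrow> bern_mean A F 1 = F A"
  by (induction A arbitrary: F rule: finite_induct) (auto simp: bern_mean_insert)

lemma bern_mean_reindex:
  assumes "finite A" "inj_on f A"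
  shows "bern_mean (f ` A) F p = bern_mean A (\<lambda>T. F (f ` T)) p"
  using assms
  by (induction A arbitrary: F rule: finite_induct) (simp_all add: bern_mean_insert)

lemma continuous_on_bern_mean [continuous_intros]: "continuous_on S (bern_mean A F)"
  unfolding bern_mean_def by (intro continuous_intros)

lemma bern_mean_pos:
  assumes "finite A" "\<And>T. T \<subseteq> A \<Longrightarrow> 0 < F T" "0 \<le> p" "p \<le> 1"
  shows "0 < bern_mean A F p"
  using assms(1,2)
proof (induction A arbitrary: F rule: finite_induct)
  case (insert x A)
  have a: "0 < bern_mean A (\<lambda>T. F (insert x T)) p"
    by (rule insert.IH) (use insert.prems in \<open>blast intro: insert_mono\<close>)
  have b: "0 < bern_mean A F p"
    by (rule insert.IH) (use insert.prems in blast)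
  show ?case
  \<comment> \<open>One of the two weights may vanish: at \<open>p = 0\<close> positivity comes from
    the sets without \<open>x\<close>, otherwise from those with \<open>x\<close>.\<close>
  proof (cases "p = 0")
    case False
    with a b assms(3,4) show ?thesis
      by (simp add: bern_mean_insert insert.hyps add_pos_nonneg)
  qed (use a b in \<open>simp add: bern_mean_insert insert.hyps\<close>)
qed simp

lemma bern_mean_nonneg:
  assumes "\<And>T. T \<subseteq> A \<Longrightarrow> 0 \<le> F T" "0 \<le> p" "p \<le> 1"
  shows "0 \<le> bern_mean A F p"
  unfolding bern_mean_def using assms by (intro sum_nonneg mult_nonneg_nonneg) auto

lemma bern_mean_mono:
  assumes "finite A" "\<And>x T. x \<in> A \<Longrightarrow> T \<subseteq> A - {x} \<Longrightarrow> F T \<le> F (insert x T)"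
    and pq: "0 \<le> p" "p \<le> q" "q \<le> 1"
  shows "bern_mean A F p \<le> bern_mean A F q"
  using assms(1,2)
proof (induction A arbitrary: F rule: finite_induct)
  case (insert x A)
  let ?G = "\<lambda>T. F (insert x T)"
  have G: "bern_mean A ?G p \<le> bern_mean A ?G q"
  proof (rule insert.IH)
    fix y T assume "y \<in> A" "T \<subseteq> A - {y}"
    then show "F (insert x T) \<le> F (insert x (insert y T))"
      using insert.prems[of y "insert x T"] insert.hyps by (auto simp: insert_commute)
  qed
  have F: "bern_mean A F p \<le> bern_mean A F q"
    by (rule insert.IH) (use insert.prems in auto)
  have "0 \<le> bern_mean A (\<lambda>T. ?G T - F T) q"
    by (rule bern_mean_nonneg) (use insert.prems[of x] insert.hyps pq in auto)
  then have FG: "bern_mean A F q \<le> bern_mean A ?G q"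
    by (simp add: bern_mean_diff)
  \<comment> \<open>Pass from \<open>p\<close> to \<open>q\<close> in two stages: first in the means
    over \<open>A\<close>, then in the weight of \<open>x\<close>. The second stage helps because
    adding \<open>x\<close> never lowers \<open>F\<close>.\<close>
  have "p * bern_mean A ?G p + (1 - p) * bern_mean A F p
      \<le> p * bern_mean A ?G q + (1 - p) * bern_mean A F q"
    using F G pq by (intro add_mono mult_left_mono) auto
  also have "\<dots> = bern_mean A F q + p * (bern_mean A ?G q - bern_mean A F q)"
    by (simp add: algebra_simps)
  also have "\<dots> \<le> bern_mean A F q + q * (bern_mean A ?G q - bern_mean A F q)"
    using FG pq by (intro add_left_mono mult_right_mono) auto
  also have "\<dots> = q * bern_mean A ?G q + (1 - q) * bern_mean A F q"
    by (simp add: algebra_simps)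
  finally show ?case
    by (simp add: bern_mean_insert insert.hyps)
qed simp

text \<open>One element \<open>x\<close> supplies the strictness: raising its weight from
  \<open>p\<close> to \<open>q\<close> moves mass to a conditional mean that is strictly larger.
  Weak monotonicity handles the other elements.\<close>

lemma bern_mean_strict_mono:
  assumes A: "finite A" "A \<noteq> {}"
    and F: "\<And>x T. x \<in> A \<Longrightarrow> T \<subseteq> A - {x} \<Longrightarrow> F T < F (insert x T)"
    and pq: "0 \<le> p" "p < q" "q \<le> 1"
  shows "bern_mean A F p < bern_mean A F q"
proof -
  obtain x B where B: "A = insert x B" "x \<notin> B"
    using A(2) by (meson ex_in_conv mk_disjoint_insert)
  have fin: "finite B" using A(1) B by simp
  have F': "F T \<le> F (insert x T)" if "x \<in> A" "T \<subseteq> A - {x}" for x T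
    using F[OF that] by simp
  let ?G = "\<lambda>T. F (insert x T)"
  have mG: "bern_mean B ?G p \<le> bern_mean B ?G q"
  proof (rule bern_mean_mono[OF fin])
    fix y T assume "y \<in> B" "T \<subseteq> B - {y}"
    then show "F (insert x T) \<le> F (insert x (insert y T))"
      using F'[of y "insert x T"] B by (auto simp: insert_commute)
  qed (use pq in auto)
  have mF: "bern_mean B F p \<le> bern_mean B F q"
    by (rule bern_mean_mono[OF fin]) (use F' B pq in auto)
  have "0 < bern_mean B (\<lambda>T. ?G T - F T) q"
    by (rule bern_mean_pos) (use F[of x] B fin pq in auto)
  then have FG: "bern_mean B F q < bern_mean B ?G q"
    by (simp add: bern_mean_diff)
  have "p * bern_mean B ?G p + (1 - p) * bern_mean B F p
      \<le> p * bern_mean B ?G q + (1 - p) * bern_mean B F q"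
    using mF mG pq by (intro add_mono mult_left_mono) auto
  also have "\<dots> = bern_mean B F q + p * (bern_mean B ?G q - bern_mean B F q)"
    by (simp add: algebra_simps)
  also have "\<dots> < bern_mean B F q + q * (bern_mean B ?G q - bern_mean B F q)"
    using FG pq by (intro add_strict_left_mono mult_strict_right_mono) auto
  also have "\<dots> = q * bern_mean B ?G q + (1 - q) * bern_mean B F q"
    by (simp add: algebra_simps)
  finally show ?thesis
    by (simp add: B(1) bern_mean_insert fin B(2))
qed

section \<open>Expectations under mixed strategies\<close>

text \<open>The value 0 off \<open>A\<close> is the default of \<open>Pi_pmf A 0\<close>, so these
  vectors are the outcomes of independent play by the users in \<open>A\<close>, indexed by the set
  \<open>T\<close> of private ones.\<close>

definition split_profile :: "ennreal \<Rightarrow> ennreal \<Rightarrow> nat set \<Rightarrow> nat set \<Rightarrow> nat \<Rightarrow> ennreal" where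
  "split_profile r1 r2 A T = (\<lambda>j. if j \<in> A then if j \<in> T then r1 else r2 else 0)"

lemma finite_set_Pi_mixed:
  "finite A \<Longrightarrow> finite (set_pmf (Pi_pmf A 0 (\<lambda>j. mixed r1 r2 (p j))))"
  by (intro finite_subset[OF set_Pi_pmf_subset'] finite_PiE_dflt) (auto simp: mixed_def)

text \<open>The probabilities may vary with the user, so that one user can deviate from the common
  strategy.\<close>

lemma expectation_Pi_mixed_insert:
  assumes "finite A" "x \<notin> A" "0 \<le> p x" "p x \<le> 1"
  shows "measure_pmf.expectation (Pi_pmf (insert x A) 0 (\<lambda>j. mixed r1 r2 (p j))) G =
    p x * measure_pmf.expectation (Pi_pmf A 0 (\<lambda>j. mixed r1 r2 (p j))) (\<lambda>f. G (f(x := r1))) +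
    (1 - p x) * measure_pmf.expectation (Pi_pmf A 0 (\<lambda>j. mixed r1 r2 (p j))) (\<lambda>f. G (f(x := r2)))"
proof -
  let ?P = "Pi_pmf A 0 (\<lambda>j. mixed r1 r2 (p j))"
  let ?K = "\<lambda>b. map_pmf (\<lambda>f. f(x := (if b then r1 else r2))) ?P"
  have "Pi_pmf (insert x A) 0 (\<lambda>j. mixed r1 r2 (p j)) = bind_pmf (bernoulli_pmf (p x)) ?K"
    using assms by (simp add: Pi_pmf_insert' mixed_def bind_map_pmf map_pmf_def bind_assoc_pmf bind_return_pmf)
  also have "measure_pmf.expectation \<dots> G =
      (\<Sum>b\<in>UNIV. pmf (bernoulli_pmf (p x)) b *\<^sub>R measure_pmf.expectation (?K b) G)"
    using assms(1) by (intro pmf_expectation_bind) (auto simp: finite_set_Pi_mixed)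
  finally show ?thesis
    using assms(3,4) by (simp add: UNIV_bool fun_upd_def)
qed

lemma expectation_Pi_mixed:
  assumes "finite A" "0 \<le> p" "p \<le> 1"
  shows "measure_pmf.expectation (Pi_pmf A 0 (\<lambda>_. mixed r1 r2 p)) G =
    bern_mean A (\<lambda>T. G (split_profile r1 r2 A T)) p"
  using assms(1)
proof (induction A arbitrary: G rule: finite_induct)
  case empty
  show ?case by (simp add: split_profile_def)
next
  case (insert x A)
  have r1: "(split_profile r1 r2 A T)(x := r1) = split_profile r1 r2 (insert x A) (insert x T)"
    if "T \<subseteq> A" for T
    using that by (auto simp: split_profile_def fun_eq_iff)
  have r2: "(split_profile r1 r2 A T)(x := r2) = split_profile r1 r2 (insert x A) T"
    if "T \<subseteq> A" for T
    using that insert.hyps by (auto simp: split_profile_def fun_eq_iff)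
  show ?case
    using assms(2,3) insert.hyps
    by (simp add: expectation_Pi_mixed_insert[where p = "\<lambda>_. p"] insert.IH bern_mean_insert r1 r2
        cong: bern_mean_cong)
qed


section \<open>The game among the users\<close>

text \<open>The hypothesis \<open>nonneg\<close> makes the expected utility nonnegative on [0,1] and
  positive below 1, so at a fixed equilibrium a lower payment factor is never worse for the
  platform. The choice of \<open>i\<close> is immaterial by
  \<open>relative_payoff_user_independent\<close>.\<close>

locale privacy_game =
  fixes N i :: nat and r1 r2 :: ennreal and U :: "(nat \<Rightarrow> ennreal) \<Rightarrow> real"
  assumes N: "N \<ge> 2" and r12: "r1 < r2" and i: "i \<in> {1..N}"
    and symm: "equal_marginal_contribution N r1 r2 U"
    and mono: "monotone_utility N r1 r2 U"
    and dimin: "diminishing_returns N r1 r2 U"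
    and nonneg: "U (restr {1..N} (\<lambda>_. r1)) \<ge> 0"
begin

declare One_nat_def [simp del]

abbreviation others :: "nat \<Rightarrow> nat set" where
  "others j \<equiv> {1..N} - {j}"

abbreviation (input) profile_for :: "nat \<Rightarrow> nat set \<Rightarrow> ennreal \<Rightarrow> nat \<Rightarrow> ennreal" where
  "profile_for j T r \<equiv> (split_profile r1 r2 (others j) T)(j := r)"

section \<open>The value of switching to the less private level\<close>

definition gain :: "nat \<Rightarrow> nat set \<Rightarrow> real" where
  "gain j T = fair_value N U j (profile_for j T r2) - fair_value N U j (profile_for j T r1)"

lemma profile_for_in_profiles: "r = r1 \<or> r = r2 \<Longrightarrow> profile_for j T r \<in> profiles N r1 r2"
  by (auto simp: profiles_def split_profile_def)

lemma relative_payoff_eq: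
  assumes "0 \<le> p" "p \<le> 1"
  shows "relative_payoff N r1 r2 U j p = bern_mean (others j) (gain j) p"
  using assms by (simp add: relative_payoff_def expectation_Pi_mixed gain_def[abs_def])

text \<open>Coalitions without \<open>j\<close> do not see the level of \<open>j\<close>, so their
  terms cancel. What remains is a positive combination of marginal increases, to which the two
  assumptions on \<open>U\<close> apply.\<close>

lemma gain_eq:
  "gain j T = 1 / real N * (\<Sum>S\<in>Pow (others j).
     1 / real ((N - 1) choose card S) * marginal_increase r2 U j (insert j S) (profile_for j T r1))"
proof -
  let ?w = "\<lambda>S. 1 / real ((N - 1) choose card S)"
  let ?d = "\<lambda>r S. U (restr (insert j S) (profile_for j T r)) - U (restr S (profile_for j T r))"
  have "gain j T = 1 / real N * (\<Sum>S\<in>Pow (others j). ?w S * ?d r2 S - ?w S * ?d r1 S)"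
    by (simp only: gain_def fair_value_def sum_subtractf right_diff_distrib[of "1 / real N"])
  also have "(\<Sum>S\<in>Pow (others j). ?w S * ?d r2 S - ?w S * ?d r1 S) =
    (\<Sum>S\<in>Pow (others j). ?w S * marginal_increase r2 U j (insert j S) (profile_for j T r1))"
  proof (intro sum.cong refl)
    fix S assume "S \<in> Pow (others j)"
    then have "restr S (profile_for j T r2) = restr S (profile_for j T r1)"
      by (auto simp: restr_def fun_eq_iff)
    moreover have "restr (insert j S) (profile_for j T r2) = (restr (insert j S) (profile_for j T r1))(j := r2)"
      by (auto simp: restr_def fun_eq_iff)
    ultimately show "?w S * ?d r2 S - ?w S * ?d r1 S =
        ?w S * marginal_increase r2 U j (insert j S) (profile_for j T r1)"
      by (simp only: marginal_increase_def right_diff_distrib[symmetric]) simp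
  qed
  finally show ?thesis .
qed

lemma choose_card_pos:
  assumes "j \<in> {1..N}" "S \<subseteq> others j"
  shows "0 < (N - 1) choose card S"
  using card_mono[OF _ assms(2)] assms(1) by simp

lemma gain_pos:
  assumes j: "j \<in> {1..N}"
  shows "0 < gain j T"
proof -
  have "0 < marginal_increase r2 U j (insert j S) (profile_for j T r1)" if S: "S \<subseteq> others j" for S
  proof -
    let ?S = "insert j S"
    have eq: "(restr ?S (profile_for j T r1))(j := r2) = restr ?S (profile_for j T r2)"
      by (auto simp: restr_def fun_eq_iff)
    have "restr ?S (profile_for j T r2) j \<noteq> restr ?S (profile_for j T r1) j"
      using r12 by (simp add: restr_def)
    then have ne: "restr ?S (profile_for j T r2) \<noteq> restr ?S (profile_for j T r1)"
      by metis
    have le: "\<forall>k\<in>{1..N}. restr ?S (profile_for j T r1) k \<le> restr ?S (profile_for j T r2) k"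
      using r12 by (auto simp: restr_def)
    have "?S \<subseteq> {1..N}" using S j by auto
    then have "U (restr ?S (profile_for j T r1)) < U (restr ?S (profile_for j T r2))"
      using mono ne le profile_for_in_profiles[of r1 j T] profile_for_in_profiles[of r2 j T]
      unfolding monotone_utility_def by blast
    then show ?thesis
      by (simp add: marginal_increase_def eq)
  qed
  then show ?thesis
    unfolding gain_eq using N j choose_card_pos[OF j]
    by (intro mult_pos_pos sum_pos) auto
qed

text \<open>Only coalitions containing \<open>x\<close> notice that \<open>x\<close> became private.
  For these the number of private users grows, so diminishing returns makes the increase of
  \<open>j\<close> strictly larger.\<close>

lemma gain_insert:
  assumes j: "j \<in> {1..N}" and x: "x \<in> others j" and T: "T \<subseteq> others j - {x}"
  shows "gain j T < gain j (insert x T)"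
proof -
  let ?P = "profile_for j T r1" and ?Q = "profile_for j (insert x T) r1"
  let ?m = "\<lambda>S \<rho>. 1 / real ((N - 1) choose card S) * marginal_increase r2 U j (insert j S) \<rho>"
  have less: "?m S ?P < ?m S ?Q" if S: "S \<subseteq> others j" "x \<in> S" for S
  proof -
    have "{k \<in> insert j S. ?P k = r1} \<subseteq> {k \<in> insert j S. ?Q k = r1}"
      by (auto simp: split_profile_def)
    moreover have "x \<in> {k \<in> insert j S. ?Q k = r1}" "x \<notin> {k \<in> insert j S. ?P k = r1}"
      using x T S r12 by (auto simp: split_profile_def)
    ultimately have "{k \<in> insert j S. ?P k = r1} \<subset> {k \<in> insert j S. ?Q k = r1}"
      by blast
    moreover have "finite S" using S finite_subset by blast
    ultimately have "n_private r1 (insert j S) ?P < n_private r1 (insert j S) ?Q"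
      unfolding n_private_def by (intro psubset_card_mono) auto
    moreover have "insert j S \<subseteq> {1..N}" "?P j = r1" "?Q j = r1"
      using S j by auto
    ultimately have "marginal_increase r2 U j (insert j S) ?P < marginal_increase r2 U j (insert j S) ?Q"
      using dimin profile_for_in_profiles[of r1 j T] profile_for_in_profiles[of r1 j "insert x T"]
      unfolding diminishing_returns_def by blast
    then show ?thesis
      using choose_card_pos[OF j S(1)] by (intro mult_strict_left_mono) auto
  qed
  have le: "?m S ?P \<le> ?m S ?Q" if S: "S \<subseteq> others j" for S
  proof (cases "x \<in> S")
    case False
    then have "restr (insert j S) ?P = restr (insert j S) ?Q"
      using x by (auto simp: restr_def split_profile_def fun_eq_iff)
    then show ?thesis by (simp add: marginal_increase_def)
  qed (use less[OF S] in simp)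
  have "(\<Sum>S\<in>Pow (others j). ?m S ?P) < (\<Sum>S\<in>Pow (others j). ?m S ?Q)"
  \<comment> \<open>The coalition \<open>{x}\<close> gives a strict term.\<close>
  proof (rule sum_strict_mono_ex1)
    show "\<exists>S\<in>Pow (others j). ?m S ?P < ?m S ?Q"
      using less[of "{x}"] x by blast
  qed (use le in auto)
  then show ?thesis
    unfolding gain_eq using N by (intro mult_strict_left_mono) auto
qed

section \<open>Independence of the user\<close>

lemma fair_value_permute:
  assumes \<pi>: "\<pi> permutes {1..N}" and j: "j \<in> {1..N}" and \<rho>: "\<rho> \<in> profiles N r1 r2"
  shows "fair_value N U j (\<rho> \<circ> \<pi>) = fair_value N U (\<pi> j) \<rho>"
proof -
  have inj: "inj \<pi>" using \<pi> permutes_inj by blast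
  have img: "\<pi> ` others j = others (\<pi> j)"
    using inj permutes_image[OF \<pi>] by (simp add: image_set_diff)
  have restr: "restr S (\<rho> \<circ> \<pi>) = restr (\<pi> ` S) \<rho> \<circ> \<pi>" for S
    using inj by (auto simp: restr_def fun_eq_iff inj_image_mem_iff)
  have inv: "U (restr S (\<rho> \<circ> \<pi>)) = U (restr (\<pi> ` S) \<rho>)" if "S \<subseteq> {1..N}" for S
  proof -
    have "\<pi> ` S \<subseteq> {1..N}" using that permutes_image[OF \<pi>] by blast
    then show ?thesis
      using symm \<pi> \<rho> unfolding restr equal_marginal_contribution_def by blast
  qed
  \<comment> \<open>Coalitions are relabelled by \<open>S\<close> to its image under \<pi>, which
    preserves cardinalities and hence the Shapley weights.\<close>
  have "(\<Sum>S\<in>Pow (others (\<pi> j)). 1 / real ((N - 1) choose card S) * (U (restr (insert (\<pi> j) S) \<rho>) - U (restr S \<rho>)))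
     = (\<Sum>S\<in>Pow (others j). 1 / real ((N - 1) choose card (\<pi> ` S)) * (U (restr (insert (\<pi> j) (\<pi> ` S)) \<rho>) - U (restr (\<pi> ` S) \<rho>)))"
    unfolding img[symmetric] image_Pow_surj[OF refl, symmetric]
    by (subst sum.reindex) (use inj in \<open>auto simp: inj_on_def inj_image_eq_iff\<close>)
  also have "\<dots> = (\<Sum>S\<in>Pow (others j). 1 / real ((N - 1) choose card S) * (U (restr (insert j S) (\<rho> \<circ> \<pi>)) - U (restr S (\<rho> \<circ> \<pi>))))"
  proof (intro sum.cong refl)
    fix S assume "S \<in> Pow (others j)"
    then have S: "S \<subseteq> {1..N}" "insert j S \<subseteq> {1..N}" using j by auto
    have "card (\<pi> ` S) = card S"
      using inj by (intro card_image) (auto simp: inj_on_def)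
    then show "1 / real ((N - 1) choose card (\<pi> ` S)) * (U (restr (insert (\<pi> j) (\<pi> ` S)) \<rho>) - U (restr (\<pi> ` S) \<rho>)) =
      1 / real ((N - 1) choose card S) * (U (restr (insert j S) (\<rho> \<circ> \<pi>)) - U (restr S (\<rho> \<circ> \<pi>)))"
      using inv[OF S(1)] inv[OF S(2)] by simp
  qed
  finally show ?thesis
    by (simp add: fair_value_def)
qed

text \<open>Exchanging \<open>j\<close> and \<open>k\<close> carries the situation of one to that of
  the other. Equilibrium conditions for all users can thus be stated with the payoff of
  \<open>i\<close> alone.\<close>

lemma relative_payoff_user_independent:
  assumes j: "j \<in> {1..N}" and k: "k \<in> {1..N}" and p: "0 \<le> p" "p \<le> 1"
  shows "relative_payoff N r1 r2 U j p = relative_payoff N r1 r2 U k p"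
proof -
  define \<pi> where "\<pi> = Transposition.transpose j k"
  have \<pi>: "\<pi> permutes {1..N}" "\<pi> j = k" "inj \<pi>"
    unfolding \<pi>_def using j k by (auto intro: permutes_swap_id)
  have img: "\<pi> ` others j = others k"
    using \<pi> permutes_image[OF \<pi>(1)] by (simp add: image_set_diff)
  have gain: "gain k (\<pi> ` T) = gain j T" if T: "T \<subseteq> others j" for T
  proof -
    have "profile_for k (\<pi> ` T) r \<circ> \<pi> = profile_for j T r" for r
    proof
      fix l
      have "\<pi> l = k \<longleftrightarrow> l = j" "\<pi> l \<in> \<pi> ` T \<longleftrightarrow> l \<in> T" "\<pi> l \<in> {1..N} \<longleftrightarrow> l \<in> {1..N}"
        using \<pi> permutes_in_image[OF \<pi>(1)] by (auto simp: inj_eq inj_image_mem_iff)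
      then show "(profile_for k (\<pi> ` T) r \<circ> \<pi>) l = profile_for j T r l"
        by (simp add: split_profile_def)
    qed
    then show ?thesis
      using fair_value_permute[OF \<pi>(1) j profile_for_in_profiles[of _ k "\<pi> ` T"]] \<pi>(2)
      by (simp add: gain_def)
  qed
  have "bern_mean (others k) (gain k) p = bern_mean (others j) (\<lambda>T. gain k (\<pi> ` T)) p"
    unfolding img[symmetric] using \<pi>(3) by (intro bern_mean_reindex) (auto simp: inj_on_def)
  also have "\<dots> = bern_mean (others j) (gain j) p"
    by (intro bern_mean_cong gain)
  finally show ?thesis
    using p by (simp add: relative_payoff_eq)
qed

section \<open>Relative payoff and expected utility as functions of p\<close>

abbreviation payoff :: "real \<Rightarrow> real" where
  "payoff \<equiv> relative_payoff N r1 r2 U i"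

abbreviation util :: "real \<Rightarrow> real" where
  "util \<equiv> expected_utility N r1 r2 U"

text \<open>Strict growth of \<open>payoff\<close> requires another user whose choice can vary; this
  is where \<open>N \<ge> 2\<close> is essential.\<close>

lemma others_nonempty: "others i \<noteq> {}"
proof -
  have "card {1..N} > card {i}" using N by simp
  then show ?thesis using card_mono[of "{i}" "{1..N}"] by auto
qed

lemma payoff_pos: "0 \<le> p \<Longrightarrow> p \<le> 1 \<Longrightarrow> 0 < payoff p"
  by (subst relative_payoff_eq) (auto intro: bern_mean_pos gain_pos[OF i])

lemma payoff_less: "0 \<le> p \<Longrightarrow> p < q \<Longrightarrow> q \<le> 1 \<Longrightarrow> payoff p < payoff q"
  using bern_mean_strict_mono[OF _ others_nonempty gain_insert[OF i]]
  by (simp add: relative_payoff_eq)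

lemma continuous_on_payoff: "continuous_on {0..1} payoff"
proof -
  have "continuous_on {0..1} (bern_mean (others i) (gain i))"
    by (intro continuous_intros)
  then show ?thesis
    by (rule continuous_on_eq) (auto simp: relative_payoff_eq)
qed

lemma util_eq:
  "0 \<le> p \<Longrightarrow> p \<le> 1 \<Longrightarrow> util p = bern_mean {1..N} (\<lambda>T. U (split_profile r1 r2 {1..N} T)) p"
  by (simp add: expected_utility_def expectation_Pi_mixed)

lemma continuous_on_util: "continuous_on {0..1} util"
proof -
  have "continuous_on {0..1} (bern_mean {1..N} (\<lambda>T. U (split_profile r1 r2 {1..N} T)))"
    by (intro continuous_intros)
  then show ?thesis
    by (rule continuous_on_eq) (auto simp: util_eq)
qed

lemma util_1_nonneg: "0 \<le> util 1"
proof -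
  have "split_profile r1 r2 {1..N} {1..N} = restr {1..N} (\<lambda>_. r1)"
    by (auto simp: split_profile_def restr_def)
  then show ?thesis
    using nonneg by (simp add: util_eq bern_mean_1)
qed

lemma util_less:
  assumes "0 \<le> p" "p < q" "q \<le> 1"
  shows "util q < util p"
proof -
  let ?F = "\<lambda>T. U (split_profile r1 r2 {1..N} T)"
  \<comment> \<open>\<open>U\<close> falls as the private set grows, so monotonicity of means is
    applied to its negative.\<close>
  have "bern_mean {1..N} (\<lambda>T. - ?F T) p < bern_mean {1..N} (\<lambda>T. - ?F T) q"
  proof (rule bern_mean_strict_mono)
    fix x T assume x: "x \<in> {1..N}" "T \<subseteq> {1..N} - {x}"
    let ?P = "split_profile r1 r2 {1..N} T" and ?Q = "split_profile r1 r2 {1..N} (insert x T)"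
    have eq: "restr {1..N} ?P = ?P" "restr {1..N} ?Q = ?Q"
      by (auto simp: restr_def split_profile_def fun_eq_iff)
    have "?P x \<noteq> ?Q x"
      using x r12 by (auto simp: split_profile_def)
    then have "?P \<noteq> ?Q" by metis
    moreover have "\<forall>k\<in>{1..N}. ?Q k \<le> ?P k"
      using r12 by (auto simp: split_profile_def)
    moreover have "?P \<in> profiles N r1 r2" "?Q \<in> profiles N r1 r2"
      by (auto simp: profiles_def split_profile_def)
    ultimately have "U (restr {1..N} ?Q) < U (restr {1..N} ?P)"
      using mono eq unfolding monotone_utility_def by (metis order_refl)
    then show "- ?F T < - ?F (insert x T)"
      by (simp add: eq)
  qed (use N assms in auto)
  then show ?thesis
    using assms by (simp add: util_eq bern_mean_uminus)
qed

section \<open>Symmetric equilibria\<close>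

lemma deviation_utility_eq:
  assumes j: "j \<in> {1..N}" and p: "0 \<le> p" "p \<le> 1" and q: "0 \<le> q" "q \<le> 1"
  shows "deviation_utility N r1 r2 U c a j q p =
    a * bern_mean (others j) (\<lambda>T. fair_value N U j (profile_for j T r1)) p + (1 - q) * (a * payoff p - c)"
proof -
  let ?F = "\<lambda>r T. fair_value N U j (profile_for j T r)"
  have ins: "{1..N} = insert j (others j)" using j by auto
  have Pi: "Pi_pmf (others j) 0 (\<lambda>k. mixed r1 r2 (if k = j then q else p)) = Pi_pmf (others j) 0 (\<lambda>_. mixed r1 r2 p)"
    by (rule Pi_pmf_cong) auto
  have "payoff p = bern_mean (others j) (?F r2) p - bern_mean (others j) (?F r1) p"
    using relative_payoff_user_independent[OF i j p] p
    by (simp add: relative_payoff_eq gain_def[abs_def] bern_mean_diff)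
  \<comment> \<open>Condition on the own draw of \<open>j\<close>: the cost \<open>c\<close> arises
    only in the \<open>r2\<close> branch, and the others play \<open>p\<close> in both.\<close>
  moreover have "deviation_utility N r1 r2 U c a j q p =
      q * bern_mean (others j) (\<lambda>T. a * ?F r1 T) p + (1 - q) * bern_mean (others j) (\<lambda>T. a * ?F r2 T - c) p"
    unfolding deviation_utility_def
    by (subst ins, subst expectation_Pi_mixed_insert)
      (use p q r12 in \<open>simp_all add: Pi expectation_Pi_mixed user_utility_def less_imp_neq bern_mean_cmult\<close>)
  ultimately show ?thesis
    by (simp add: bern_mean_diff bern_mean_cmult bern_mean_const) (simp add: algebra_simps)
qed

lemma NE_iff:
  "p \<in> NE N r1 r2 U c a \<longleftrightarrow>
     0 \<le> p \<and> p \<le> 1 \<and> (0 < p \<longrightarrow> a * payoff p \<le> c) \<and> (p < 1 \<longrightarrow> c \<le> a * payoff p)"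
proof (cases "0 \<le> p \<and> p \<le> 1")
  case True
  have "p \<in> NE N r1 r2 U c a \<longleftrightarrow>
    (\<forall>q\<in>{0..1}. (1 - q) * (a * payoff p - c) \<le> (1 - p) * (a * payoff p - c))"
    using True i by (auto simp: NE_def deviation_utility_eq)
  also have "\<dots> \<longleftrightarrow> (\<forall>q\<in>{0..1}. 0 \<le> (q - p) * (a * payoff p - c))"
    by (simp add: algebra_simps)
  also have "\<dots> \<longleftrightarrow> (0 < p \<longrightarrow> a * payoff p \<le> c) \<and> (p < 1 \<longrightarrow> c \<le> a * payoff p)" (is "?L \<longleftrightarrow> ?R")
  proof
    assume ?L
    \<comment> \<open>An affine function of \<open>q\<close> is controlled by the two pure
      deviations.\<close>
    then have "0 \<le> (0 - p) * (a * payoff p - c)" "0 \<le> (1 - p) * (a * payoff p - c)"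
      by (metis atLeastAtMost_iff order_refl zero_le_one)+
    then show ?R using True by (auto simp: zero_le_mult_iff mult_le_0_iff)
  next
    assume R: ?R
    show ?L
    proof
      fix q :: real assume "q \<in> {0..1}"
      then show "0 \<le> (q - p) * (a * payoff p - c)"
        using R True by (cases "p = 0"; cases "p = 1") (auto simp: zero_le_mult_iff)
    qed
  qed
  finally show ?thesis using True by simp
qed (auto simp: NE_def)


section \<open>The platform's problem\<close>

lemma payoff_mono: "0 \<le> p \<Longrightarrow> p \<le> q \<Longrightarrow> q \<le> 1 \<Longrightarrow> payoff p \<le> payoff q"
  using payoff_less[of p q] by (cases "p = q") auto

lemma util_pos: "0 \<le> p \<Longrightarrow> p < 1 \<Longrightarrow> 0 < util p"
  using util_less[of p 1] util_1_nonneg by simp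

lemma util_nonneg: "0 \<le> p \<Longrightarrow> p \<le> 1 \<Longrightarrow> 0 \<le> util p"
  using util_pos[of p] util_1_nonneg by (cases "p = 1") auto

lemma platform_optimal_iff:
  "platform_optimal N r1 r2 U c \<alpha> p \<longleftrightarrow>
    \<alpha> \<in> {0..1} \<and> p \<in> NE N r1 r2 U c \<alpha> \<and>
    (\<forall>a\<in>{0..1}. \<forall>s\<in>NE N r1 r2 U c a. (1 - a) * util s \<le> (1 - \<alpha>) * util p)"
  unfolding platform_optimal_def is_arg_max_def by (auto simp: not_less)

text \<open>A properly mixed equilibrium forces indifference, which determines \<open>a\<close> from
  \<open>s\<close>; a pure one only yields an inequality, leaving \<open>a\<close> free on one
  side.\<close>

lemma NE_cases:
  assumes "s \<in> NE N r1 r2 U c a"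
  obtains "s = 0" "c \<le> a * payoff 0"
  | "0 < s" "s \<le> 1" "a = c / payoff s"
  | "s = 1" "a * payoff 1 \<le> c"
proof -
  consider "s = 0" | "0 < s" "s < 1" | "s = 1"
    using assms unfolding NE_iff by linarith
  then show thesis
  proof cases
    case 2
    then have "a * payoff s = c" "payoff s \<noteq> 0"
      using assms payoff_pos[of s] by (auto simp: NE_iff)
    then show thesis using 2 that(2) by (auto simp: field_simps)
  qed (use assms that in \<open>auto simp: NE_iff\<close>)
qed

text \<open>At this factor a user is indifferent between the levels when the others play
  \<open>p\<close>. It may exceed 1, so its range is checked at each use.\<close>

lemma NE_at_inverse:
  assumes "0 \<le> p" "p \<le> 1"
  shows "p \<in> NE N r1 r2 U c (c / payoff p)"
  using assms payoff_pos[of p] by (simp add: NE_iff)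

section \<open>The threshold set and its maximum\<close>

lemma threshold_ratio_iff:
  assumes "a < 1"
  shows "x / (1 - a) - util s / util 0 \<ge> 0 \<longleftrightarrow> (1 - a) * util s \<le> x * util 0"
  using assms util_pos[of 0] by (simp add: divide_simps mult.commute)

text \<open>With denominators cleared, the condition compares platform values: the right side is
  what the cheapest factor \<open>c / payoff 0\<close> earns at the equilibrium 0.\<close>

lemma threshold_set_iff:
  "c \<in> threshold_set N r1 r2 U (payoff 0) \<longleftrightarrow>
    0 \<le> c \<and> (\<forall>a\<in>{0..<1}. a \<le> c / payoff 0 \<longrightarrow>
      (\<forall>s\<in>NE N r1 r2 U c a. (1 - a) * util s \<le> (1 - c / payoff 0) * util 0))"
  unfolding threshold_set_def mem_Collect_eq
  by (intro conj_cong ball_cong imp_cong refl threshold_ratio_iff) auto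

text \<open>Eliminating the equilibria leaves, for each \<open>p\<close>, an inequality affine in
  \<open>c\<close>; this form gives compactness and the strict inequalities below the
  maximum.\<close>

lemma threshold_set_eq:
  "threshold_set N r1 r2 U (payoff 0) =
    {c \<in> {0..payoff 0}. util 1 \<le> (1 - c / payoff 0) * util 0 \<and>
      (\<forall>p\<in>{0..1}. (1 - c / payoff p) * util p \<le> (1 - c / payoff 0) * util 0)}"
  (is "?T = ?R")
proof (intro equalityI subsetI)
  fix c assume c: "c \<in> ?T"
  then have c0: "0 \<le> c" by (simp add: threshold_set_def)
  have T: "(1 - a) * util p \<le> (1 - c / payoff 0) * util 0"
    if "0 \<le> a" "a < 1" "a \<le> c / payoff 0" "p \<in> NE N r1 r2 U c a" for a p
    using c that unfolding threshold_set_iff by auto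
  have g0: "0 < payoff 0" by (simp add: payoff_pos)
  have u1: "util 1 \<le> (1 - c / payoff 0) * util 0"
    using T[of 0 1] c0 g0 by (simp add: NE_iff)
  then have nn: "0 \<le> (1 - c / payoff 0) * util 0"
    using util_1_nonneg by linarith
  \<comment> \<open>As \<open>util 0\<close> is positive, the factor \<open>1 - c / payoff 0\<close>
    cannot be negative.\<close>
  then have "c \<le> payoff 0"
    using util_pos[of 0] g0 by (simp add: zero_le_mult_iff divide_simps split: if_splits)
  moreover have "(1 - c / payoff p) * util p \<le> (1 - c / payoff 0) * util 0" if p: "p \<in> {0..1}" for p
  proof (cases "c / payoff p < 1")
    case True
    have "payoff 0 \<le> payoff p" using payoff_mono[of 0 p] p by simp
    then have "c / payoff p \<le> c / payoff 0"
      using g0 c0 by (intro divide_left_mono) auto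
    then show ?thesis
      using T[of "c / payoff p" p] True p NE_at_inverse[of p c] c0 payoff_pos[of p] by auto
  next
    \<comment> \<open>This factor lies outside the range [0,1) of the threshold condition, but then
      the left side is at most 0.\<close>
    case False
    then have "(1 - c / payoff p) * util p \<le> 0"
      using util_nonneg[of p] p by (intro mult_nonpos_nonneg) auto
    then show ?thesis using nn by linarith
  qed
  ultimately show "c \<in> ?R" using c0 u1 by auto
next
  fix c assume c: "c \<in> ?R"
  have "(1 - a) * util s \<le> (1 - c / payoff 0) * util 0"
    if a: "0 \<le> a" "a \<le> c / payoff 0" and s: "s \<in> NE N r1 r2 U c a" for a s
    using s
  proof (cases rule: NE_cases)
    case 1
    \<comment> \<open>With the assumed upper bound on \<open>a\<close> this is an equality.\<close>
    then have "c / payoff 0 \<le> a" using payoff_pos[of 0] by (simp add: divide_simps)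
    then show ?thesis using a 1 by simp
  next
    case 2
    then show ?thesis using c by auto
  next
    case 3
    have "(1 - a) * util 1 \<le> 1 * util 1"
      using a util_1_nonneg by (intro mult_right_mono) auto
    then show ?thesis using c 3 by simp
  qed
  then show "c \<in> ?T"
    using c unfolding threshold_set_iff by auto
qed

text \<open>An intersection of closed sets with a bounded interval is compact, and 0 belongs to it
  because \<open>util\<close> is largest at 0.\<close>

lemma threshold_exists: "\<exists>m. is_greatest (threshold_set N r1 r2 U (payoff 0)) m"
proof -
  let ?H = "\<lambda>p. {c. (1 - c / payoff p) * util p \<le> (1 - c / payoff 0) * util 0}"
  have T: "threshold_set N r1 r2 U (payoff 0) =
    {0..payoff 0} \<inter> ({c. util 1 \<le> (1 - c / payoff 0) * util 0} \<inter> (\<Inter>p\<in>{0..1}. ?H p))"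
    unfolding threshold_set_eq by auto
  have "closed (?H p)" if "p \<in> {0..1}" for p
    using that payoff_pos[of p] payoff_pos[of 0] by (intro closed_Collect_le continuous_intros) auto
  moreover have "closed {c. util 1 \<le> (1 - c / payoff 0) * util 0}"
    using payoff_pos[of 0] by (intro closed_Collect_le continuous_intros) auto
  ultimately have "compact (threshold_set N r1 r2 U (payoff 0))"
    unfolding T by (intro compact_Int_closed closed_Int closed_INT) auto
  moreover have "0 \<in> threshold_set N r1 r2 U (payoff 0)"
  proof -
    have "util p \<le> util 0" if "p \<in> {0..1}" for p
      using util_less[of 0 p] that by (cases "p = 0") auto
    then show ?thesis
      unfolding threshold_set_eq using payoff_pos[of 0] by auto
  qed
  ultimately show ?thesis
    using compact_attains_sup[of "threshold_set N r1 r2 U (payoff 0)"]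
    by (auto simp: is_greatest_def)
qed

section \<open>The three regimes\<close>

lemma above_max_payoff:
  assumes "payoff 1 < c"
  shows "0 \<in> optimal_alphas N r1 r2 U c \<and> (0 < util 1 \<longrightarrow> optimal_alphas N r1 r2 U c = {0})"
proof -
  \<comment> \<open>Even full payment falls short of the cost, so 1 is the only equilibrium.\<close>
  have g: "a * payoff s < c" if "0 \<le> a" "a \<le> 1" "0 \<le> s" "s \<le> 1" for a s
  proof -
    have "a * payoff s \<le> 1 * payoff s"
      using that payoff_pos[of s] by (intro mult_right_mono) auto
    then show ?thesis using payoff_mono[of s 1] that assms by simp
  qed
  have NE: "NE N r1 r2 U c a = {1}" if "a \<in> {0..1}" for a
  proof (intro set_eqI)
    fix s
    show "s \<in> NE N r1 r2 U c a \<longleftrightarrow> s \<in> {1}"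
      using g[of a s] g[of a 1] that by (cases "s = 1") (auto simp: NE_iff)
  qed
  have opt: "platform_optimal N r1 r2 U c 0 1"
    using util_1_nonneg by (auto simp: platform_optimal_iff NE mult_left_le_one_le)
  moreover have "a = 0" if "platform_optimal N r1 r2 U c a p" "0 < util 1" for a p
  proof -
    have a: "a \<in> {0..1}" and p: "p \<in> NE N r1 r2 U c a"
      and best: "\<forall>b\<in>{0..1}. \<forall>s\<in>NE N r1 r2 U c b. (1 - b) * util s \<le> (1 - a) * util p"
      using that(1) unfolding platform_optimal_iff by auto
    have "p = 1" "1 \<in> NE N r1 r2 U c 0"
      using p NE[OF a] NE[of 0] by auto
    then have "util 1 \<le> (1 - a) * util 1"
      using best[rule_format, of 0 1] by simp
    then show "a = 0" using that(2) a by simp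
  qed
  ultimately show ?thesis
    by (auto simp: optimal_alphas_def)
qed

lemma below_threshold:
  assumes m: "m \<in> threshold_set N r1 r2 U (payoff 0)" and c: "0 \<le> c" "c < m"
  shows "is_smallest {a \<in> {0..1}. 0 \<in> NE N r1 r2 U c a} (c / payoff 0)"
    and "optimal_alphas N r1 r2 U c = {c / payoff 0}"
proof -
  let ?a = "c / payoff 0"
  have g0: "0 < payoff 0" and v0: "0 < util 0"
    by (simp_all add: payoff_pos util_pos)
  have m_le: "m \<le> payoff 0" and m1: "util 1 \<le> (1 - m / payoff 0) * util 0"
    and mp: "\<And>p. p \<in> {0..1} \<Longrightarrow> (1 - m / payoff p) * util p \<le> (1 - m / payoff 0) * util 0"
    using m unfolding threshold_set_eq by auto
  have NE0: "0 \<in> NE N r1 r2 U c a \<longleftrightarrow> ?a \<le> a" for a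
    using g0 by (simp add: NE_iff divide_simps)
  have a: "?a \<in> {0..1}"
    using c m_le g0 by simp
  show "is_smallest {a \<in> {0..1}. 0 \<in> NE N r1 r2 U c a} ?a"
    using a by (auto simp: is_smallest_def NE0)
  have strict: "(1 - c / payoff p) * util p < (1 - ?a) * util 0" if p: "0 < p" "p \<le> 1" for p
  proof -
    \<comment> \<open>The inequality at \<open>p\<close> reads \<open>c * ?K < ?D\<close>. If
      \<open>?K\<close> is positive it follows from the weak one at \<open>m > c\<close>, otherwise
      from \<open>?D > 0\<close>.\<close>
    let ?D = "util 0 - util p" and ?K = "util 0 / payoff 0 - util p / payoff p"
    have D: "0 < ?D" using util_less[of 0 p] p by simp
    have mK: "m * ?K \<le> ?D" using mp[of p] p by (simp add: algebra_simps)
    have "c * ?K < ?D"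
    proof (cases "0 < ?K")
      case True
      then have "c * ?K < m * ?K" using c by (intro mult_strict_right_mono)
      then show ?thesis using mK by linarith
    next
      case False
      then have "c * ?K \<le> 0" using c by (intro mult_nonneg_nonpos) auto
      then show ?thesis using D by linarith
    qed
    then show ?thesis by (simp add: algebra_simps)
  qed
  have strict1: "util 1 < (1 - ?a) * util 0"
  proof -
    have "?a < m / payoff 0" using c g0 by (simp add: divide_strict_right_mono)
    then have "(1 - m / payoff 0) * util 0 < (1 - ?a) * util 0"
      using v0 by (intro mult_strict_right_mono) auto
    then show ?thesis using m1 by linarith
  qed
  have best: "b = ?a \<or> (1 - b) * util s < (1 - ?a) * util 0"
    if b: "b \<in> {0..1}" and s: "s \<in> NE N r1 r2 U c b" for b s
    using s
  proof (cases rule: NE_cases)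
    case 1
    then have "?a \<le> b" using s NE0 by simp
    then show ?thesis using 1 v0 by auto
  next
    case 2
    then show ?thesis using strict by simp
  next
    case 3
    have "(1 - b) * util 1 \<le> util 1"
      using b util_1_nonneg by (simp add: mult_left_le_one_le)
    then show ?thesis using 3 strict1 by simp
  qed
  \<comment> \<open>\<open>best\<close> is silent on strategies when \<open>b = ?a\<close>. For
    \<open>c = 0\<close> this factor is 0 and every strategy is an equilibrium.\<close>
  have NE_a: "(1 - ?a) * util s \<le> (1 - ?a) * util 0" if "s \<in> NE N r1 r2 U c ?a" for s
    using that util_less[of 0 s] a by (cases "s = 0") (auto simp: NE_iff intro!: mult_left_mono)
  have opt: "platform_optimal N r1 r2 U c ?a 0"
    unfolding platform_optimal_iff
  proof (intro conjI ballI)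
    fix b s assume "b \<in> {0..1}" "s \<in> NE N r1 r2 U c b"
    then show "(1 - b) * util s \<le> (1 - ?a) * util 0"
      using best[of b s] NE_a[of s] by auto
  qed (use a NE0 in auto)
  moreover have "b = ?a" if "platform_optimal N r1 r2 U c b s" for b s
  proof -
    have "(1 - ?a) * util 0 \<le> (1 - b) * util s" "b \<in> {0..1}" "s \<in> NE N r1 r2 U c b"
      using that a NE0[of ?a] unfolding platform_optimal_iff by blast+
    then show ?thesis using best[of b s] by auto
  qed
  ultimately show "optimal_alphas N r1 r2 U c = {?a}"
    unfolding optimal_alphas_def by blast
qed

text \<open>Every feasible value is bounded by that of a pair \<open>(c / payoff p, p)\<close> with
  \<open>payoff p \<ge> c\<close>, or of \<open>(0, 1)\<close>. The former range over a compact set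
  of \<open>p\<close>, nonempty since it contains 1.\<close>

lemma platform_optimal_exists:
  assumes c: "0 \<le> c" "c \<le> payoff 1"
  shows "\<exists>a p. platform_optimal N r1 r2 U c a p"
proof -
  define K where "K = {0..1} \<inter> payoff -` {c..}"
  let ?F = "\<lambda>p. (1 - c / payoff p) * util p"
  have "closed K"
    unfolding K_def by (intro continuous_closed_preimage continuous_on_payoff) auto
  then have "compact K"
    using compact_Int_closed[of "{0..1}" K] by (simp add: K_def Int_absorb1)
  moreover have "1 \<in> K" using c by (simp add: K_def)
  moreover have "continuous_on K ?F"
    using payoff_pos
    by (intro continuous_intros continuous_on_subset[OF continuous_on_payoff]
        continuous_on_subset[OF continuous_on_util]) (force simp: K_def)+
  ultimately obtain p0 where p0: "p0 \<in> K" "\<And>p. p \<in> K \<Longrightarrow> ?F p \<le> ?F p0"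
    using continuous_attains_sup[of K ?F] by blast
  have p0': "0 \<le> p0" "p0 \<le> 1" "c / payoff p0 \<in> {0..1}"
    using p0(1) c payoff_pos[of p0] by (auto simp: K_def)
  have le: "(1 - a) * util s \<le> max (?F p0) (util 1)"
    if a: "a \<in> {0..1}" and s: "s \<in> NE N r1 r2 U c a" for a s
    using s
  proof (cases rule: NE_cases)
    case 1
    have g0: "0 < payoff 0" by (simp add: payoff_pos)
    have "a * payoff 0 \<le> 1 * payoff 0" using a g0 by (intro mult_right_mono) auto
    then have "0 \<in> K" using 1 by (simp add: K_def)
    \<comment> \<open>Lowering \<open>a\<close> to \<open>c / payoff 0\<close> keeps the equilibrium
      0 and does not lower the value.\<close>
    moreover have "(1 - a) * util 0 \<le> ?F 0"
      using 1 g0 util_pos[of 0] by (intro mult_right_mono) (auto simp: field_simps)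
    ultimately show ?thesis using p0(2)[of 0] 1 by simp
  next
    case 2
    have "a * payoff s \<le> 1 * payoff s"
      using a 2 payoff_pos[of s] by (intro mult_right_mono) auto
    then have "c \<le> payoff s" using 2 payoff_pos[of s] by simp
    then show ?thesis using p0(2)[of s] 2 by (simp add: K_def)
  next
    case 3
    have "(1 - a) * util 1 \<le> util 1"
      using a util_1_nonneg by (simp add: mult_left_le_one_le)
    then show ?thesis using 3 by simp
  qed
  show ?thesis
  proof (cases "util 1 \<le> ?F p0")
    case True
    then have "platform_optimal N r1 r2 U c (c / payoff p0) p0"
      using le p0' NE_at_inverse[of p0 c] by (simp add: platform_optimal_iff max_absorb1)
    then show ?thesis by blast
  next
    case False
    then have "platform_optimal N r1 r2 U c 0 1"
      using le c by (simp add: platform_optimal_iff max_absorb2) (simp add: NE_iff)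
    then show ?thesis by blast
  qed
qed

text \<open>Excludes an optimum of value 0, at which the factor would not be determined when
  \<open>util 1 = 0\<close>.\<close>

lemma positive_value_exists:
  assumes c: "0 \<le> c" "c < payoff 1"
  shows "\<exists>a\<in>{0..1}. \<exists>s\<in>NE N r1 r2 U c a. 0 < (1 - a) * util s"
proof -
  \<comment> \<open>A value of \<open>payoff\<close> above \<open>c\<close>, so that the factor
    \<open>c / ?y\<close> is below 1, and under \<open>payoff 1\<close>, so that it is attained at
    some \<open>s < 1\<close> with positive utility.\<close>
  let ?y = "(max c (payoff 0) + payoff 1) / 2"
  have y: "c < ?y" "payoff 0 \<le> ?y" "?y < payoff 1"
    using c payoff_less[of 0 1] by auto
  then obtain s where s: "0 \<le> s" "s \<le> 1" "payoff s = ?y"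
    using IVT'[of payoff 0 ?y 1] continuous_on_payoff by auto
  then have "s < 1" using y(3) by (cases "s = 1") auto
  then have "0 < util s" using s util_pos by simp
  moreover have "0 \<le> c / payoff s" "c / payoff s < 1"
    unfolding s(3) using y c by auto
  ultimately show ?thesis
    using NE_at_inverse[OF s(1,2), of c] by (intro bexI[of _ "c / payoff s"] bexI[of _ s]) auto
qed

lemma between_thresholds:
  assumes m: "is_greatest (threshold_set N r1 r2 U (payoff 0)) m" and c: "m < c" "c < payoff 1"
    and opt: "platform_optimal N r1 r2 U c a p"
  shows "p \<noteq> 0"
    and "is_smallest {b \<in> {0..1}. p \<in> inv_relative_payoff N r1 r2 U i (ereal c / ereal b)} a"
proof -
  have "0 \<le> m"
    using m by (auto simp: is_greatest_def threshold_set_def)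
  then have c0: "0 < c" using c by simp
  have a: "0 \<le> a" "a \<le> 1" and p: "p \<in> NE N r1 r2 U c a"
    and best: "\<And>b s. b \<in> {0..1} \<Longrightarrow> s \<in> NE N r1 r2 U c b \<Longrightarrow> (1 - b) * util s \<le> (1 - a) * util p"
    using opt unfolding platform_optimal_iff by auto
  have p01: "0 \<le> p" "p \<le> 1" using p by (auto simp: NE_iff)
  have pos: "0 < (1 - a) * util p"
    using positive_value_exists[of c] c c0 best by force
  show p0: "p \<noteq> 0"
  proof
    assume "p = 0"
    then have "c / payoff 0 \<le> a"
      using p payoff_pos[of 0] by (simp add: NE_iff divide_simps)
    then have "(1 - a) * util p \<le> (1 - c / payoff 0) * util 0"
      using \<open>p = 0\<close> util_pos[of 0] by (simp add: mult_right_mono)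
    \<comment> \<open>Optimality bounds all feasible values by the value at 0, so \<open>c\<close>
      would satisfy the threshold condition, against the maximality of \<open>m\<close>.\<close>
    then have "c \<in> threshold_set N r1 r2 U (payoff 0)"
      using best c0 unfolding threshold_set_iff by force
    then show False using m c by (auto simp: is_greatest_def)
  qed
  show "is_smallest {b \<in> {0..1}. p \<in> inv_relative_payoff N r1 r2 U i (ereal c / ereal b)} a"
  proof (cases "p = 1")
    case True
    have "util 1 \<le> (1 - a) * util 1"
      using best[of 0 1] c0 True by (simp add: NE_iff)
    moreover have "0 < util 1"
      using pos True util_1_nonneg by (auto simp: zero_less_mult_iff)
    ultimately have "a = 0" using a by simp
    \<comment> \<open>For \<open>c > 0\<close>, \<open>ereal c / ereal 0\<close> is infinite and its
      inverse image is \<open>{1}\<close> by convention, so 0 itself belongs to the set.\<close>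
    then show ?thesis
      using True c0 by (simp add: is_smallest_def inv_relative_payoff_def)
  next
    case False
    then have g: "a * payoff p = c" "0 < payoff p"
      using p p0 p01 payoff_pos[of p] by (auto simp: NE_iff)
    \<comment> \<open>Indifference leaves a single candidate; \<open>b = 0\<close> is excluded since
      \<open>p\<close> differs from 1.\<close>
    have iff: "p \<in> inv_relative_payoff N r1 r2 U i (ereal c / ereal b) \<longleftrightarrow> b = a" if "0 \<le> b" for b
    proof (cases "b = 0")
      case True
      then show ?thesis using False c0 g by (auto simp: inv_relative_payoff_def)
    next
      case b: False
      then have "p \<in> inv_relative_payoff N r1 r2 U i (ereal c / ereal b) \<longleftrightarrow> payoff p = c / b"
        using p01 by (simp add: inv_relative_payoff_def)
      also have "\<dots> \<longleftrightarrow> b = a"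
        using g b by (auto simp: field_simps)
      finally show ?thesis .
    qed
    have "{b \<in> {0..1}. p \<in> inv_relative_payoff N r1 r2 U i (ereal c / ereal b)} = {b \<in> {0..1}. b = a}"
      by (intro Collect_cong conj_cong refl iff) simp
    then show ?thesis using a by (simp add: is_smallest_def)
  qed
qed

lemma payoff_image_bounds:
  "is_greatest (payoff ` {0..1}) (payoff 1)" "is_smallest (payoff ` {0..1}) (payoff 0)"
  by (auto simp: is_greatest_def is_smallest_def intro: payoff_mono)

end

theorem theorem3:
  fixes N i :: nat and r1 r2 :: ennreal and U :: "(nat \<Rightarrow> ennreal) \<Rightarrow> real"
  assumes "N \<ge> 2" and "r1 < r2" and "i \<in> {1..N}"
    and "equal_marginal_contribution N r1 r2 U"
    and "monotone_utility N r1 r2 U"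
    and "diminishing_returns N r1 r2 U"
    and "U (restr {1..N} (\<lambda>_. r1)) \<ge> 0"
  shows "\<exists>\<gamma>max \<gamma>min c_th.
    is_greatest (relative_payoff N r1 r2 U i ` {0..1}) \<gamma>max \<and>
    is_smallest (relative_payoff N r1 r2 U i ` {0..1}) \<gamma>min \<and>
    is_greatest (threshold_set N r1 r2 U \<gamma>min) c_th \<and>
    c_th < \<gamma>max \<and>
    (\<forall>c\<ge>0.
      (c > \<gamma>max \<longrightarrow>
         0 \<in> optimal_alphas N r1 r2 U c \<and>
         (expected_utility N r1 r2 U 1 > 0 \<longrightarrow> optimal_alphas N r1 r2 U c = {0})) \<and>
      (c_th < c \<and> c < \<gamma>max \<longrightarrow>
         optimal_alphas N r1 r2 U c \<noteq> {} \<and>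
         (\<forall>\<alpha> p. platform_optimal N r1 r2 U c \<alpha> p \<longrightarrow>
            p \<noteq> 0 \<and>
            is_smallest {a \<in> {0..1}. p \<in> inv_relative_payoff N r1 r2 U i (ereal c / ereal a)} \<alpha>)) \<and>
      (c < c_th \<longrightarrow>
         (\<exists>\<alpha>. is_smallest {a \<in> {0..1}. 0 \<in> NE N r1 r2 U c a} \<alpha> \<and>
              optimal_alphas N r1 r2 U c = {\<alpha>})))"
proof -
  interpret privacy_game N i r1 r2 U
    using assms by unfold_locales
  obtain m where m: "is_greatest (threshold_set N r1 r2 U (payoff 0)) m"
    using threshold_exists by blast
  then have "m \<le> payoff 0" and mT: "m \<in> threshold_set N r1 r2 U (payoff 0)"
    unfolding is_greatest_def threshold_set_eq by auto
  \<comment> \<open>As \<open>payoff\<close> increases, its extremes are \<open>payoff 0\<close> and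
    \<open>payoff 1\<close>; the threshold is at most the former.\<close>
  then have m_less: "m < payoff 1"
    using payoff_less[of 0 1] by simp
  have nonempty: "optimal_alphas N r1 r2 U c \<noteq> {}" if "0 \<le> c" "c < payoff 1" for c
    using platform_optimal_exists[of c] that by (auto simp: optimal_alphas_def)
  show ?thesis
  proof (rule exI[of _ "payoff 1"], rule exI[of _ "payoff 0"], rule exI[of _ m], intro conjI allI impI)
    fix c :: real assume "payoff 1 < c"
    from above_max_payoff[OF this] show "0 \<in> optimal_alphas N r1 r2 U c"
      by (rule conjunct1)
  next
    fix c :: real assume "payoff 1 < c" and u: "0 < util 1"
    from above_max_payoff[OF this(1)] u show "optimal_alphas N r1 r2 U c = {0}"
      by simp
  next
    fix c :: real assume "0 \<le> c" "m < c \<and> c < payoff 1"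
    then show "optimal_alphas N r1 r2 U c \<noteq> {}"
      using nonempty by simp
  next
    fix c \<alpha> p assume c: "m < c \<and> c < payoff 1" and "platform_optimal N r1 r2 U c \<alpha> p"
    note * = between_thresholds[OF m conjunct1[OF c] conjunct2[OF c] this(2)]
    show "p \<noteq> 0" by (rule *(1))
  next
    fix c \<alpha> p assume c: "m < c \<and> c < payoff 1" and "platform_optimal N r1 r2 U c \<alpha> p"
    note * = between_thresholds[OF m conjunct1[OF c] conjunct2[OF c] this(2)]
    show "is_smallest {a \<in> {0..1}. p \<in> inv_relative_payoff N r1 r2 U i (ereal c / ereal a)} \<alpha>"
      by (rule *(2))
  next
    fix c :: real assume c: "0 \<le> c" "c < m"
    show "\<exists>\<alpha>. is_smallest {a \<in> {0..1}. 0 \<in> NE N r1 r2 U c a} \<alpha> \<and>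
        optimal_alphas N r1 r2 U c = {\<alpha>}"
      by (intro exI[of _ "c / payoff 0"] conjI below_threshold[OF mT c])
  qed (fact payoff_image_bounds m m_less)+
qed

end
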